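(* Let $G$ be a group and $U$ a set. If $f_A$ and $f_B$ are normal soft int-groups in $G$ over $U$, then $f_A\ast f_B$ is a normal soft int-group in $G$ over $U$.
   Context: Let $P(U)$ be the power set of $U$. For $A\subseteq G$, a soft set $f_A$ in $G$ over $U$ is a function $f_A:G\to P(U)$ with $f_A(x)=\emptyset$ for $x\notin A$. (Different subscripts denote possibly different functions.) A soft set $f_A$ is a soft int-group in $G$ if $f_A(xy)\supseteq f_A(x)\cap f_A(y)$ and $f_A(x^{-1})=f_A(x)$ for all $x,y\in G$; it is a normal soft int-group if moreover $f_A(xy)=f_A(yx)$ for all $x,y\in G$. The soft product is defined by $(f_A\ast f_B)(x)=\bigcup\{f_A(u)\cap f_B(v): u,v\in G,\ uv=x\}$ for all $x\in G$. *)

theory Defs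
  imports "HOL-Algebra.Group"
begin

text \<open>
  A function on \<open>G\<close> is represented by a total function of which only the values on
  \<^term>\<open>carrier G\<close> matter. The set \<open>A\<close> is the subscript of \<open>f\<^sub>A\<close>.
\<close>

definition soft_set :: "('a, 'm) monoid_scheme \<Rightarrow> 'u set \<Rightarrow> 'a set \<Rightarrow> ('a \<Rightarrow> 'u set) \<Rightarrow> bool"
  where "soft_set G U A f \<longleftrightarrow>
    A \<subseteq> carrier G \<and> f \<in> carrier G \<rightarrow> Pow U \<and> (\<forall>x\<in>carrier G. x \<notin> A \<longrightarrow> f x = {})"

definition soft_int_group :: "('a, 'm) monoid_scheme \<Rightarrow> 'u set \<Rightarrow> 'a set \<Rightarrow> ('a \<Rightarrow> 'u set) \<Rightarrow> bool"
  where "soft_int_group G U A f \<longleftrightarrow>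
    soft_set G U A f \<and>
    (\<forall>x\<in>carrier G. \<forall>y\<in>carrier G. f x \<inter> f y \<subseteq> f (x \<otimes>\<^bsub>G\<^esub> y)) \<and>
    (\<forall>x\<in>carrier G. f (inv\<^bsub>G\<^esub> x) = f x)"

definition normal_soft_int_group ::
    "('a, 'm) monoid_scheme \<Rightarrow> 'u set \<Rightarrow> 'a set \<Rightarrow> ('a \<Rightarrow> 'u set) \<Rightarrow> bool"
  where "normal_soft_int_group G U A f \<longleftrightarrow>
    soft_int_group G U A f \<and>
    (\<forall>x\<in>carrier G. \<forall>y\<in>carrier G. f (x \<otimes>\<^bsub>G\<^esub> y) = f (y \<otimes>\<^bsub>G\<^esub> x))"

definition soft_product ::
    "('a, 'm) monoid_scheme \<Rightarrow> ('a \<Rightarrow> 'u set) \<Rightarrow> ('a \<Rightarrow> 'u set) \<Rightarrow> 'a \<Rightarrow> 'u set"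
  where "soft_product G f g x =
    \<Union>{f u \<inter> g v | u v. u \<in> carrier G \<and> v \<in> carrier G \<and> u \<otimes>\<^bsub>G\<^esub> v = x}"

end

theory Submission
  imports Defs
begin

lemma mem_soft_product:
  "a \<in> soft_product G f g x \<longleftrightarrow>
    (\<exists>u\<in>carrier G. \<exists>v\<in>carrier G. u \<otimes>\<^bsub>G\<^esub> v = x \<and> a \<in> f u \<and> a \<in> g v)"
  unfolding soft_product_def by blast

text \<open>The premises are ordered so that the factorization and the two memberships can be
  chained in as facts, leaving only the carrier conditions.\<close>

lemma soft_productI:
  "\<lbrakk>u \<otimes>\<^bsub>G\<^esub> v = x; a \<in> f u; a \<in> g v; u \<in> carrier G; v \<in> carrier G\<rbrakk>
    \<Longrightarrow> a \<in> soft_product G f g x"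
  unfolding mem_soft_product by blast

context group
begin

lemma inv_mult_cancel_left:
  assumes "x \<in> carrier G" "y \<in> carrier G"
  shows "inv x \<otimes> (x \<otimes> y) = y" and "x \<otimes> (inv x \<otimes> y) = y"
  using assms by (simp_all flip: m_assoc)

lemma normal_soft_int_groupD:
  assumes "normal_soft_int_group G U A f"
  shows "x \<in> carrier G \<Longrightarrow> f x \<subseteq> U"
    and "\<lbrakk>x \<in> carrier G; y \<in> carrier G; a \<in> f x; a \<in> f y\<rbrakk> \<Longrightarrow> a \<in> f (x \<otimes> y)"
    and "x \<in> carrier G \<Longrightarrow> f (inv x) = f x"
    and "\<lbrakk>x \<in> carrier G; y \<in> carrier G\<rbrakk> \<Longrightarrow> f (x \<otimes> y) = f (y \<otimes> x)"
  using assms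
  unfolding normal_soft_int_group_def soft_int_group_def soft_set_def by blast+

lemma normal_soft_int_group_conj:
  assumes "normal_soft_int_group G U A f" and "x \<in> carrier G" "y \<in> carrier G"
  shows "f (y \<otimes> x \<otimes> inv y) = f x"
proof -
  have "f (y \<otimes> x \<otimes> inv y) = f (inv y \<otimes> (y \<otimes> x))"
    using normal_soft_int_groupD(4)[OF assms(1)] assms(2,3) by simp
  also have "inv y \<otimes> (y \<otimes> x) = x"
    using assms(2,3) by (simp add: inv_mult_cancel_left)
  finally show ?thesis .
qed

text \<open>With \<open>x = u v\<close> and \<open>y = s t\<close>, moving \<open>s\<close> to the
  left past \<open>v\<close> conjugates \<open>v\<close> by \<open>inv s\<close>, and
  \<open>g\<close> does not see this conjugation.\<close>

lemma soft_product_mult: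
  assumes f: "normal_soft_int_group G U A f" and g: "normal_soft_int_group G U B g"
    and a: "a \<in> soft_product G f g x" "a \<in> soft_product G f g y"
  shows "a \<in> soft_product G f g (x \<otimes> y)"
proof -
  obtain u v where uv: "u \<in> carrier G" "v \<in> carrier G" "u \<otimes> v = x" "a \<in> f u" "a \<in> g v"
    using a(1) unfolding mem_soft_product by blast
  obtain s t where st: "s \<in> carrier G" "t \<in> carrier G" "s \<otimes> t = y" "a \<in> f s" "a \<in> g t"
    using a(2) unfolding mem_soft_product by blast
  have "(u \<otimes> s) \<otimes> (inv s \<otimes> v \<otimes> s \<otimes> t) = x \<otimes> y"
    using uv(1-3) st(1-3) by (auto simp: m_assoc inv_mult_cancel_left)
  moreover have "a \<in> f (u \<otimes> s)"
    using normal_soft_int_groupD(2)[OF f] uv st by blast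
  moreover have "g (inv s \<otimes> v \<otimes> s) = g v"
    using normal_soft_int_group_conj[OF g, of v "inv s"] uv st by simp
  then have "a \<in> g (inv s \<otimes> v \<otimes> s \<otimes> t)"
    using normal_soft_int_groupD(2)[OF g] uv st by simp
  ultimately show ?thesis
    by (rule soft_productI) (use uv st in simp_all)
qed

text \<open>The inverse of \<open>u v\<close> is \<open>inv v\<close> times \<open>inv u\<close>,
  with the factors in the wrong order for \<open>f\<close> and \<open>g\<close>; conjugating
  \<open>inv v\<close> by \<open>u\<close> restores the order.\<close>

lemma soft_product_inv_subset:
  assumes f: "normal_soft_int_group G U A f" and g: "normal_soft_int_group G U B g"
  shows "soft_product G f g x \<subseteq> soft_product G f g (inv x)"
proof
  fix a assume "a \<in> soft_product G f g x"
  then obtain u v where uv: "u \<in> carrier G" "v \<in> carrier G" "u \<otimes> v = x" "a \<in> f u" "a \<in> g v"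
    unfolding mem_soft_product by blast
  have "inv u \<otimes> (u \<otimes> inv v \<otimes> inv u) = inv x"
    using uv(1-3) by (auto simp: inv_mult_group m_assoc inv_mult_cancel_left)
  moreover have "a \<in> f (inv u)"
    using normal_soft_int_groupD(3)[OF f] uv by simp
  moreover have "a \<in> g (u \<otimes> inv v \<otimes> inv u)"
    using normal_soft_int_group_conj[OF g] normal_soft_int_groupD(3)[OF g] uv by simp
  ultimately show "a \<in> soft_product G f g (inv x)"
    by (rule soft_productI) (use uv in simp_all)
qed

text \<open>The element \<open>y x\<close> is the conjugate of \<open>x y\<close> by
  \<open>y\<close>, so it suffices to conjugate both factors by \<open>y\<close>.\<close>

lemma soft_product_commute_subset:
  assumes f: "normal_soft_int_group G U A f" and g: "normal_soft_int_group G U B g"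
    and x: "x \<in> carrier G" and y: "y \<in> carrier G"
  shows "soft_product G f g (x \<otimes> y) \<subseteq> soft_product G f g (y \<otimes> x)"
proof
  fix a assume "a \<in> soft_product G f g (x \<otimes> y)"
  then obtain u v where uv:
      "u \<in> carrier G" "v \<in> carrier G" "u \<otimes> v = x \<otimes> y" "a \<in> f u" "a \<in> g v"
    unfolding mem_soft_product by blast
  have "(y \<otimes> u \<otimes> inv y) \<otimes> (y \<otimes> v \<otimes> inv y) = y \<otimes> (u \<otimes> v) \<otimes> inv y"
    using uv(1,2) y by (simp add: m_assoc inv_mult_cancel_left)
  also have "\<dots> = y \<otimes> x"
    using x y uv(3) by (simp add: m_assoc)
  finally have "(y \<otimes> u \<otimes> inv y) \<otimes> (y \<otimes> v \<otimes> inv y) = y \<otimes> x" .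
  moreover have "a \<in> f (y \<otimes> u \<otimes> inv y)" "a \<in> g (y \<otimes> v \<otimes> inv y)"
    using normal_soft_int_group_conj[OF f] normal_soft_int_group_conj[OF g] uv y by simp_all
  ultimately show "a \<in> soft_product G f g (y \<otimes> x)"
    by (rule soft_productI) (use uv y in simp_all)
qed

text \<open>Taking the whole carrier as subscript makes the support condition vacuous.\<close>

lemma normal_soft_int_group_soft_product:
  assumes f: "normal_soft_int_group G U A f" and g: "normal_soft_int_group G U B g"
  shows "normal_soft_int_group G U (carrier G) (soft_product G f g)"
proof -
  have "soft_product G f g x \<subseteq> U" for x
    using subsetD[OF normal_soft_int_groupD(1)[OF f]] by (auto simp: mem_soft_product)
  moreover have "soft_product G f g (inv x) = soft_product G f g x" if "x \<in> carrier G" for x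
    \<comment> \<open>The instance at \<open>inv x\<close> gives the reverse inclusion, as inversion
      is an involution.\<close>
    using soft_product_inv_subset[OF f g, of x] soft_product_inv_subset[OF f g, of "inv x"] that
    by auto
  moreover have "soft_product G f g (x \<otimes> y) = soft_product G f g (y \<otimes> x)"
    if "x \<in> carrier G" "y \<in> carrier G" for x y
    using soft_product_commute_subset[OF f g] that by blast
  ultimately show ?thesis
    unfolding normal_soft_int_group_def soft_int_group_def soft_set_def
    by (auto intro: soft_product_mult[OF f g])
qed

end

theorem corollary3p21:
  fixes G :: "('a, 'm) monoid_scheme" and U :: "'u set"
    and A B :: "'a set" and f g :: "'a \<Rightarrow> 'u set"
  assumes "group G"
    and "normal_soft_int_group G U A f"
    and "normal_soft_int_group G U B g"
  shows "\<exists>C. normal_soft_int_group G U C (soft_product G f g)"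
  using group.normal_soft_int_group_soft_product[OF assms] ..

end
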